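(* Let $f$ be a Perron function with good continuity. Then the two spectra $\sigma_{f,\inf}$ and $\sigma_{f,\sup}$ are closed subsets of $[-\infty,\infty]$.
   Context: $\mathbb{N}^+=\{1,2,\dots\}$. Fix an integer $l\ge 0$. A Perron function is a function $f:[0,1]^2\times(\mathbb{N}^+\cup\{\infty\})^l\to[-\infty,\infty]$, $(\alpha,\beta,n_0,\dots,n_{l-1})\mapsto f(\alpha,\beta,n_0,\dots,n_{l-1})$. It has good continuity if: (i) there is $I\in[-\infty,\infty]$ such that for every neighbourhood $B$ of $I$ in $[-\infty,\infty]$ there is $C$ with $f(\alpha,\beta,n_0,\dots,n_{l-1})\in B$ for all $\alpha,\beta\in[0,1]$ and all $n_0,\dots,n_{l-1}$ with $\max(n_0,\dots,n_{l-1})>C$; moreover $f=I$ whenever some $n_i=\infty$ (this condition is vacuous if $l=0$); (ii) for all finite $n_0,\dots,n_{l-1}$ the map $(\alpha,\beta)\mapsto f(\alpha,\beta,n_0,\dots,n_{l-1})$ is continuous on $[0,1]^2$. An expansion sequence is a sequence $(s_0,s_1,\dots)$ in $\mathbb{N}^+\cup\{\infty\}$ such that either all terms are finite, or there is a first term equal to $\infty$ and no terms are defined beyond it. Continued fractions: $[0;s_0,s_1,\dots]=1/(s_0+1/(s_1+\cdots))$, with $1/\infty=0$, so $[0;s_0,\dots,s_m,\infty]=[0;s_0,\dots,s_m]$ and $[0;\infty]=0$. An admissible two-sided sequence $a$ is a sequence $(a_k)$ in $\mathbb{N}^+\cup\{\infty\}$ indexed by $\mathbb{Z}$ such that $(a_0,a_1,\dots)$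 and $(a_{-1},a_{-2},\dots)$ are both expansion sequences (so terms beyond an $\infty$ on either side are not defined). Put $\alpha^{[a]}_n=[0;a_{n+1},a_{n+2},\dots]$, $\beta^{[a]}_n=[0;a_{n-1},a_{n-2},\dots]$ and $P^{[a]}_k=f(\alpha^{[a]}_{k+l-1},\beta^{[a]}_k,a_k,\dots,a_{k+l-1})$ whenever this is defined; also $P^{[a]}_k=I$ whenever one of $a_k,\dots,a_{k+l-1}$ is defined and equal to $\infty$ (even if other entries are undefined). $\sigma_{f,\inf}$ (resp. $\sigma_{f,\sup}$) is the set of all values $\inf_k P^{[a]}_k$ (resp. $\sup_k P^{[a]}_k$), with $k$ ranging over all integers for which $P^{[a]}_k$ is defined and $a$ ranging over all admissible two-sided sequences. *)

theory Defs
  imports Complex_Main "HOL-Library.Extended_Nat" "HOL-Library.Extended_Real"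
begin

text \<open>
  A Perron function with parameter \<open>l\<close> is modelled as \<open>f :: real \<Rightarrow> real \<Rightarrow> enat list \<Rightarrow> ereal\<close>,
  where only the values \<open>f \<alpha> \<beta> ns\<close> with \<open>\<alpha>, \<beta> \<in> [0, 1]\<close> and \<open>ns \<in> perron_args l\<close> matter.
\<close>

definition perron_args :: "nat \<Rightarrow> enat list set" where
  "perron_args l = {ns. length ns = l \<and> (\<forall>n\<in>set ns. 0 < n)}"

text \<open>
  Good continuity with limit value \<open>I\<close>. Writing \<open>\<exists>n\<in>set ns. enat C < n\<close> for ``the maximum of the
  entries exceeds \<open>C\<close>'' makes the conditions on \<open>I\<close> vacuous for \<open>l = 0\<close>; for \<open>l > 0\<close> they
  determine \<open>I\<close> uniquely.
\<close>

definition good_continuity ::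
  "nat \<Rightarrow> (real \<Rightarrow> real \<Rightarrow> enat list \<Rightarrow> ereal) \<Rightarrow> ereal \<Rightarrow> bool" where
  "good_continuity l f I \<longleftrightarrow>
     (\<forall>B. open B \<and> I \<in> B \<longrightarrow>
        (\<exists>C::nat. \<forall>\<alpha>\<in>{0..1}. \<forall>\<beta>\<in>{0..1}. \<forall>ns\<in>perron_args l.
           (\<exists>n\<in>set ns. enat C < n) \<longrightarrow> f \<alpha> \<beta> ns \<in> B)) \<and>
     (\<forall>\<alpha>\<in>{0..1}. \<forall>\<beta>\<in>{0..1}. \<forall>ns\<in>perron_args l. \<infinity> \<in> set ns \<longrightarrow> f \<alpha> \<beta> ns = I) \<and>
     (\<forall>ns\<in>perron_args l. \<infinity> \<notin> set ns \<longrightarrow>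
        continuous_on ({0..1} \<times> {0..1}) (\<lambda>(\<alpha>, \<beta>). f \<alpha> \<beta> ns))"

text \<open>Undefined terms of a sequence are represented by \<open>None\<close>.\<close>

definition expansion_sequence :: "(nat \<Rightarrow> enat option) \<Rightarrow> bool" where
  "expansion_sequence s \<longleftrightarrow>
     (\<forall>i x. s i = Some x \<longrightarrow> 0 < x) \<and>
     ((\<forall>i. \<exists>n::nat. s i = Some (enat n)) \<or>
      (\<exists>m. (\<forall>i<m. \<exists>n::nat. s i = Some (enat n)) \<and> s m = Some \<infinity> \<and> (\<forall>i>m. s i = None)))"

text \<open>
  \<open>cf_convergent n s\<close> is \<open>[0; s\<^sub>0, \<dots>, s\<^sub>n\<^sub>-\<^sub>1]\<close>, with \<open>1/\<infinity> = 0\<close>; after a term \<open>\<infinity>\<close> the convergents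
  are constant. The \<open>None\<close> case at the head is irrelevant for expansion sequences.
\<close>

primrec cf_convergent :: "nat \<Rightarrow> (nat \<Rightarrow> enat option) \<Rightarrow> real" where
  "cf_convergent 0 s = 0"
| "cf_convergent (Suc n) s =
     (case s 0 of
        Some (enat m) \<Rightarrow> 1 / (real m + cf_convergent n (\<lambda>i. s (Suc i)))
      | Some \<infinity> \<Rightarrow> 0
      | None \<Rightarrow> 0)"

definition cf_value :: "(nat \<Rightarrow> enat option) \<Rightarrow> real" where
  "cf_value s = lim (\<lambda>n. cf_convergent n s)"

definition right_of :: "(int \<Rightarrow> enat option) \<Rightarrow> int \<Rightarrow> nat \<Rightarrow> enat option" where
  "right_of a n = (\<lambda>i. a (n + 1 + int i))"

definition left_of :: "(int \<Rightarrow> enat option) \<Rightarrow> int \<Rightarrow> nat \<Rightarrow> enat option" where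
  "left_of a n = (\<lambda>i. a (n - 1 - int i))"

definition admissible :: "(int \<Rightarrow> enat option) \<Rightarrow> bool" where
  "admissible a \<longleftrightarrow> expansion_sequence (right_of a (-1)) \<and> expansion_sequence (left_of a 0)"

definition cf_alpha :: "(int \<Rightarrow> enat option) \<Rightarrow> int \<Rightarrow> real" where
  "cf_alpha a n = cf_value (right_of a n)"

definition cf_beta :: "(int \<Rightarrow> enat option) \<Rightarrow> int \<Rightarrow> real" where
  "cf_beta a n = cf_value (left_of a n)"

text \<open>
  \<open>perron_value l f I a k = None\<close> means that the value at position \<open>k\<close> is undefined. The continued
  fractions count as defined exactly when their entries form an expansion sequence.
\<close>

definition perron_value ::
  "nat \<Rightarrow> (real \<Rightarrow> real \<Rightarrow> enat list \<Rightarrow> ereal) \<Rightarrow> ereal \<Rightarrow> (int \<Rightarrow> enat option) \<Rightarrow> int \<Rightarrow> ereal option"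
where
  "perron_value l f I a k =
     (if \<exists>i<l. a (k + int i) = Some \<infinity> then Some I
      else if (\<forall>i<l. a (k + int i) \<noteq> None) \<and>
              expansion_sequence (right_of a (k + int l - 1)) \<and> expansion_sequence (left_of a k)
      then Some (f (cf_alpha a (k + int l - 1)) (cf_beta a k)
                   (map (\<lambda>i. the (a (k + int i))) [0..<l]))
      else None)"

definition perron_values ::
  "nat \<Rightarrow> (real \<Rightarrow> real \<Rightarrow> enat list \<Rightarrow> ereal) \<Rightarrow> ereal \<Rightarrow> (int \<Rightarrow> enat option) \<Rightarrow> ereal set" where
  "perron_values l f I a = {x. \<exists>k. perron_value l f I a k = Some x}"

definition spectrum_inf ::
  "nat \<Rightarrow> (real \<Rightarrow> real \<Rightarrow> enat list \<Rightarrow> ereal) \<Rightarrow> ereal \<Rightarrow> ereal set" where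
  "spectrum_inf l f I = {Inf (perron_values l f I a) | a. admissible a}"

definition spectrum_sup ::
  "nat \<Rightarrow> (real \<Rightarrow> real \<Rightarrow> enat list \<Rightarrow> ereal) \<Rightarrow> ereal \<Rightarrow> ereal set" where
  "spectrum_sup l f I = {Sup (perron_values l f I a) | a. admissible a}"

end

theory Submission
  imports Defs "HOL-Library.Diagonal_Subsequence" "HOL-Analysis.Extended_Real_Limits"
begin

text \<open>
  The idea is a compactness argument. The space of admissible sequences is compact for entrywise
  convergence in \<open>\<nat>\<^sup>+ \<union> {\<infinity>}\<close>, provided that a limit is cut off at its first \<open>\<infinity>\<close> on either side
  (\<open>admissible_compact\<close>). Each value \<open>P\<^sub>k\<close> is continuous for this convergence wherever it is defined in
  the limit (\<open>perron_value_entries_tend\<close>): for finite windows because continued fractions depend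
  continuously on their entries (\<open>cf_value_entries_tend\<close>), for windows with an entry \<open>\<infinity>\<close> because \<open>f\<close>
  tends to \<open>I\<close> uniformly as an entry grows.

  Let \<open>X\<close> be a limit of infima \<open>x\<^sub>j\<close> belonging to sequences \<open>A\<^sub>j\<close>. In a limit \<open>a\<close> of a subsequence every
  value is a limit of values of the \<open>A\<^sub>j\<close>, so it is at least \<open>X\<close>. The danger is that the infimum of \<open>a\<close>
  is larger, because the positions at which the \<open>A\<^sub>j\<close> come close to their infima escape to infinity.
  Hence the \<open>A\<^sub>j\<close> are first recentred, so that the relevant value sits at position \<open>0\<close>
  (\<open>perron_value_recentre\<close>), which is a position where every admissible sequence has a value. Then the
  value of \<open>a\<close> at \<open>0\<close> is \<open>X\<close> and the infimum is attained there (\<open>perron_values_limit\<close>). This is applied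
  twice: to recentrings of one sequence, whose infimum is then attained by a limit of them, and to
  sequences whose infima are attained at position \<open>0\<close>, which gives closedness. The spectrum of suprema
  follows by passing from \<open>f\<close> to \<open>- f\<close>.
\<close>

section \<open>Continuity of continued fractions\<close>

definition positive_entries :: "('i \<Rightarrow> enat option) \<Rightarrow> bool" where
  "positive_entries s \<longleftrightarrow> (\<forall>i x. s i = Some x \<longrightarrow> 0 < x)"

lemma positive_entries_enatD: "positive_entries s \<Longrightarrow> s i = Some (enat n) \<Longrightarrow> 0 < n"
  unfolding positive_entries_def by (metis enat_ord_simps(2) zero_enat_def)

lemma cf_convergent_bounds:
  assumes "positive_entries s"
  shows "cf_convergent n s \<in> {0..1}"
  using assms
proof (induction n arbitrary: s)
  case (Suc n)
  have tail: "cf_convergent n (\<lambda>i. s (Suc i)) \<in> {0..1}"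
    using Suc.IH[of "\<lambda>i. s (Suc i)"] Suc.prems by (simp add: positive_entries_def)
  show ?case
  proof (cases "s 0")
    case (Some x)
    then show ?thesis
    proof (cases x)
      case (enat m)
      then have "0 < m"
        using Some positive_entries_enatD[OF Suc.prems, of 0 m] by simp
      then have "1 \<le> real m + cf_convergent n (\<lambda>i. s (Suc i))"
        using tail by auto
      then show ?thesis
        using Some enat by simp
    qed (use Some in simp)
  qed simp
qed auto

lemma inverse_shift_contraction:
  fixes x y d m :: real
  assumes "1 \<le> m" "0 \<le> x" "0 \<le> y" "\<bar>x - y\<bar> \<le> d"
  shows "\<bar>1 / (m + x) - 1 / (m + y)\<bar> \<le> d / (1 + d)"
proof -
  have ordered: "1 / (m + u) - 1 / (m + v) \<in> {0..d / (1 + d)}"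
    if "0 \<le> u" "u \<le> v" "v - u \<le> d" for u v
  proof -
    have "1 / (m + u) - 1 / (m + v) = (v - u) / ((m + u) * (m + v))"
      using assms(1) that by (simp add: field_simps)
    moreover have "(v - u) / ((m + u) * (m + v)) \<le> (v - u) / (1 + (v - u))"
    proof (rule divide_left_mono)
      have "1 * (1 + (v - u)) \<le> (m + u) * (m + v)"
        using assms(1) that by (intro mult_mono) auto
      then show "1 + (v - u) \<le> (m + u) * (m + v)" by simp
    qed (use assms(1) that in auto)
    moreover have "(v - u) / (1 + (v - u)) \<le> d / (1 + d)"
      using that by (simp add: field_simps)
    moreover have "0 \<le> (v - u) / ((m + u) * (m + v))"
      using assms(1) that by auto
    ultimately show ?thesis by auto
  qed
  show ?thesis
  proof (cases "x \<le> y")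
    case True
    then show ?thesis using ordered[of x y] assms by auto
  next
    case False
    then show ?thesis using ordered[of y x] assms by auto
  qed
qed

text \<open>
  The bound is uniform in the sequence. Prepending an entry turns a bound \<open>d\<close> on the difference
  of two convergents into \<open>d / (1 + d)\<close>, and this map sends \<open>1 / Suc n\<close> to \<open>1 / Suc (Suc n)\<close>.
\<close>

lemma cf_convergent_diff_le:
  assumes "positive_entries s" "n \<le> p"
  shows "\<bar>cf_convergent p s - cf_convergent n s\<bar> \<le> 1 / real (Suc n)"
  using assms
proof (induction n arbitrary: p s)
  case 0
  then show ?case using cf_convergent_bounds[of s p] by auto
next
  case (Suc n)
  then obtain q where p: "p = Suc q" "n \<le> q"
    by (cases p) auto
  let ?t = "\<lambda>i. s (Suc i)"
  have pos: "positive_entries ?t"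
    using Suc.prems by (auto simp: positive_entries_def)
  have IH: "\<bar>cf_convergent q ?t - cf_convergent n ?t\<bar> \<le> 1 / real (Suc n)"
    using Suc.IH[OF pos p(2)] .
  show ?case
  proof (cases "\<exists>m. s 0 = Some (enat m)")
    case True
    then obtain m where m: "s 0 = Some (enat m)" by blast
    then have "0 < m"
      using positive_entries_enatD[OF Suc.prems(1)] by simp
    then have "\<bar>1 / (real m + cf_convergent q ?t) - 1 / (real m + cf_convergent n ?t)\<bar>
        \<le> (1 / real (Suc n)) / (1 + 1 / real (Suc n))"
      using cf_convergent_bounds[OF pos] IH by (intro inverse_shift_contraction) auto
    also have "\<dots> = 1 / real (Suc (Suc n))"
      by (simp add: field_simps)
    finally show ?thesis using m p by simp
  next
    case False
    then have "cf_convergent p s = 0" "cf_convergent (Suc n) s = 0"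
      unfolding p by (auto split: option.splits enat.splits)
    then show ?thesis by simp
  qed
qed

lemma cf_convergent_tendsto_cf_value:
  assumes "positive_entries s"
  shows "(\<lambda>n. cf_convergent n s) \<longlonglongrightarrow> cf_value s"
proof -
  have "Cauchy (\<lambda>n. cf_convergent n s)"
    unfolding Cauchy_altdef2
  proof (intro allI impI)
    fix e :: real assume "0 < e"
    then obtain N where "inverse (real (Suc N)) < e"
      using reals_Archimedean by blast
    then show "\<exists>N. \<forall>n\<ge>N. dist (cf_convergent n s) (cf_convergent N s) < e"
      using cf_convergent_diff_le[OF assms, of N]
      by (intro exI[of _ N]) (fastforce simp: dist_real_def inverse_eq_divide)
  qed
  then show ?thesis
    unfolding cf_value_def by (simp add: Cauchy_convergent convergent_LIMSEQ_iff[symmetric])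
qed

lemma cf_value_diff_le:
  assumes "positive_entries s"
  shows "\<bar>cf_value s - cf_convergent n s\<bar> \<le> 1 / real (Suc n)"
proof (rule LIMSEQ_le_const2)
  show "(\<lambda>p. \<bar>cf_convergent p s - cf_convergent n s\<bar>)
      \<longlonglongrightarrow> \<bar>cf_value s - cf_convergent n s\<bar>"
    by (intro tendsto_intros cf_convergent_tendsto_cf_value assms)
qed (use cf_convergent_diff_le[OF assms] in blast)

lemma cf_value_bounds:
  assumes "positive_entries s"
  shows "cf_value s \<in> {0..1}"
  using closed_sequentially[OF closed_atLeastAtMost _ cf_convergent_tendsto_cf_value[OF assms]]
    cf_convergent_bounds[OF assms] by blast

text \<open>
  Entrywise convergence in the compact space of positive integers with \<open>\<infinity>\<close>. Positions where the
  limit is undefined are unconstrained: there a continued fraction has already stopped, although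
  the approximating sequences may still have entries.
\<close>

definition entries_tend :: "(nat \<Rightarrow> 'i \<Rightarrow> enat option) \<Rightarrow> ('i \<Rightarrow> enat option) \<Rightarrow> bool" where
  "entries_tend A a \<longleftrightarrow>
     (\<forall>i n. a i = Some (enat n) \<longrightarrow> (\<forall>\<^sub>F j in sequentially. A j i = Some (enat n))) \<and>
     (\<forall>i C. a i = Some \<infinity> \<longrightarrow> (\<forall>\<^sub>F j in sequentially. \<exists>x. A j i = Some x \<and> enat C < x))"

lemma entries_tend_finite:
  "entries_tend A a \<Longrightarrow> a i = Some (enat n) \<Longrightarrow> \<forall>\<^sub>F j in sequentially. A j i = Some (enat n)"
  by (auto simp: entries_tend_def)

lemma entries_tend_infinite:
  "entries_tend A a \<Longrightarrow> a i = Some \<infinity> \<Longrightarrow>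
     \<forall>\<^sub>F j in sequentially. \<exists>x. A j i = Some x \<and> enat C < x"
  by (auto simp: entries_tend_def)

lemma entries_tend_reindex: "entries_tend A a \<Longrightarrow> entries_tend (\<lambda>j i. A j (h i)) (\<lambda>i. a (h i))"
  by (simp add: entries_tend_def)

text \<open>
  The conditions on the right relate only neighbouring entries, so that finiteness and definedness
  can be propagated one position at a time.
\<close>

lemma expansion_sequence_iff:
  "expansion_sequence s \<longleftrightarrow> positive_entries s \<and> s 0 \<noteq> None \<and>
     (\<forall>i. s (Suc i) \<noteq> None \<longleftrightarrow> (\<exists>n. s i = Some (enat n)))"
  (is "?L \<longleftrightarrow> ?R")
proof
  assume L: ?L
  then have "positive_entries s"
    by (simp add: expansion_sequence_def positive_entries_def)
  moreover consider (all) "\<forall>i. \<exists>n::nat. s i = Some (enat n)"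
    | (stop) m where "\<forall>i<m. \<exists>n::nat. s i = Some (enat n)" "s m = Some \<infinity>" "\<forall>i>m. s i = None"
    using L unfolding expansion_sequence_def by blast
  then have "s 0 \<noteq> None \<and> (\<forall>i. s (Suc i) \<noteq> None \<longleftrightarrow> (\<exists>n. s i = Some (enat n)))"
  proof cases
    case all
    then show ?thesis by (metis option.distinct(1))
  next
    case stop
    have "s 0 \<noteq> None"
      using stop by (cases "m = 0") (auto dest: spec[of _ 0])
    moreover have "s (Suc i) \<noteq> None \<longleftrightarrow> (\<exists>n. s i = Some (enat n))" for i
    proof (rule linorder_cases[of i m])
      assume "i < m"
      then show ?thesis
        using stop by (cases "Suc i = m") (auto dest: spec[of _ i] spec[of _ "Suc i"])
    qed (use stop in auto)
    ultimately show ?thesis by blast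
  qed
  ultimately show ?R by blast
next
  assume R: ?R
  show ?L
  proof (cases "\<forall>i. \<exists>n::nat. s i = Some (enat n)")
    case True
    then show ?thesis
      using R by (auto simp: expansion_sequence_def positive_entries_def)
  next
    case False
    define m where "m = (LEAST i. \<nexists>n::nat. s i = Some (enat n))"
    have m: "\<nexists>n::nat. s m = Some (enat n)"
      unfolding m_def by (rule LeastI_ex) (use False in blast)
    have before: "\<exists>n::nat. s i = Some (enat n)" if "i < m" for i
      using not_less_Least that unfolding m_def by blast
    have "s m \<noteq> None"
      using R before[of "m - 1"] by (cases m) auto
    then have inf: "s m = Some \<infinity>"
      using m by (auto intro: enat.exhaust)
    have after: "s (Suc (m + k)) = None" for k
    proof (induction k)
      case 0
      have "s (Suc m) = None \<longleftrightarrow> (\<nexists>n. s m = Some (enat n))"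
        using R by blast
      then show ?case using m by simp
    next
      case (Suc k)
      have "s (Suc (Suc (m + k))) = None \<longleftrightarrow> (\<nexists>n. s (Suc (m + k)) = Some (enat n))"
        using R by blast
      then show ?case using Suc by simp
    qed
    have "\<forall>i>m. s i = None"
      using after by (auto simp: less_iff_Suc_add)
    then show ?thesis
      using R before inf unfolding expansion_sequence_def positive_entries_def by blast
  qed
qed

lemma expansion_sequence_positive: "expansion_sequence s \<Longrightarrow> positive_entries s"
  by (simp add: expansion_sequence_iff)

lemma expansion_sequence_Cons:
  assumes "s 0 = Some (enat n)" "0 < n"
  shows "expansion_sequence s \<longleftrightarrow> expansion_sequence (\<lambda>i. s (Suc i))"
proof -
  have all_nat: "(\<forall>i. P i) \<longleftrightarrow> P 0 \<and> (\<forall>i. P (Suc i))" for P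
    using not0_implies_Suc by metis
  have "positive_entries s \<longleftrightarrow> positive_entries (\<lambda>i. s (Suc i))"
    unfolding positive_entries_def all_nat[of "\<lambda>i. \<forall>x. s i = Some x \<longrightarrow> 0 < x"]
    using assms by (simp add: zero_enat_def)
  moreover have "(\<forall>i. s (Suc i) \<noteq> None \<longleftrightarrow> (\<exists>n. s i = Some (enat n))) \<longleftrightarrow>
      s (Suc 0) \<noteq> None \<and> (\<forall>i. s (Suc (Suc i)) \<noteq> None \<longleftrightarrow> (\<exists>n. s (Suc i) = Some (enat n)))"
    unfolding all_nat[of "\<lambda>i. s (Suc i) \<noteq> None \<longleftrightarrow> (\<exists>n. s i = Some (enat n))"]
    using assms(1) by simp
  ultimately show ?thesis
    unfolding expansion_sequence_iff using assms(1) by auto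
qed

lemma expansion_sequence_finite_before:
  assumes "expansion_sequence s" "s i \<noteq> None" "m < i"
  shows "\<exists>n>0. s m = Some (enat n)"
proof -
  \<comment> \<open>Downward propagation from \<open>i\<close>, written as an upward induction on the distance to \<open>m\<close>.\<close>
  have "s (Suc m + k) \<noteq> None \<Longrightarrow> \<exists>n. s m = Some (enat n)" for k
  proof (induction k)
    case 0
    then show ?case using assms(1) by (simp add: expansion_sequence_iff)
  next
    case (Suc k)
    then show ?case
      using assms(1) by (metis expansion_sequence_iff add_Suc_right option.distinct(1))
  qed
  then obtain n where "s m = Some (enat n)"
    using assms(2,3) by (metis add_Suc less_iff_Suc_add)
  then show ?thesis
    using positive_entries_enatD[OF expansion_sequence_positive[OF assms(1)]] by simp
qed

lemma cf_convergent_entries_tend: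
  assumes "\<And>j. positive_entries (S j)" "expansion_sequence s" "entries_tend S s"
  shows "(\<lambda>j. cf_convergent n (S j)) \<longlonglongrightarrow> cf_convergent n s"
  using assms
proof (induction n arbitrary: S s)
  case (Suc n)
  obtain x where x: "s 0 = Some x"
    using Suc.prems(2) by (auto simp: expansion_sequence_iff)
  show ?case
  proof (cases x)
    case (enat m)
    then have m: "0 < m"
      using x positive_entries_enatD[OF expansion_sequence_positive[OF Suc.prems(2)], of 0 m] by simp
    have tail: "expansion_sequence (\<lambda>i. s (Suc i))"
      using expansion_sequence_Cons Suc.prems(2) x enat m by blast
    have "(\<lambda>j. cf_convergent n (\<lambda>i. S j (Suc i))) \<longlonglongrightarrow> cf_convergent n (\<lambda>i. s (Suc i))"
      using Suc.IH[of "\<lambda>j i. S j (Suc i)", OF _ tail] Suc.prems(1,3)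
      by (auto simp: positive_entries_def intro: entries_tend_reindex)
    moreover have "0 \<le> cf_convergent n (\<lambda>i. s (Suc i))"
      using cf_convergent_bounds[OF expansion_sequence_positive[OF tail]] by simp
    ultimately have lim: "(\<lambda>j. 1 / (real m + cf_convergent n (\<lambda>i. S j (Suc i))))
        \<longlonglongrightarrow> cf_convergent (Suc n) s"
      using x enat m by (auto intro!: tendsto_eq_intros)
    have "\<forall>\<^sub>F j in sequentially. 1 / (real m + cf_convergent n (\<lambda>i. S j (Suc i)))
        = cf_convergent (Suc n) (S j)"
      using entries_tend_finite[OF Suc.prems(3), of 0 m] x enat by (auto elim: eventually_mono)
    then show ?thesis
      by (rule Lim_transform_eventually[OF lim])
  next
    case infinity
    have "\<forall>\<^sub>F j in sequentially. \<bar>cf_convergent (Suc n) (S j)\<bar> < e" if "0 < e" for e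
    proof -
      obtain C where C: "inverse (real (Suc C)) < e"
        using reals_Archimedean \<open>0 < e\<close> by blast
      have "\<bar>cf_convergent (Suc n) (S j)\<bar> < e" if y: "S j 0 = Some y" "enat C < y" for j y
      proof (cases y)
        case (enat k)
        have "0 \<le> cf_convergent n (\<lambda>i. S j (Suc i))"
          using cf_convergent_bounds[of "\<lambda>i. S j (Suc i)" n] Suc.prems(1)[of j]
          by (simp add: positive_entries_def)
        moreover have "real (Suc C) \<le> real k"
          using y enat by simp
        ultimately have "inverse (real k + cf_convergent n (\<lambda>i. S j (Suc i)))
            \<le> inverse (real (Suc C))"
          by (intro le_imp_inverse_le) auto
        then show ?thesis
          using C y enat \<open>0 \<le> _\<close> by (simp add: inverse_eq_divide)
      qed (use y \<open>0 < e\<close> in auto)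
      then show ?thesis
        using entries_tend_infinite[OF Suc.prems(3), of 0 C] x infinity
        by (auto elim!: eventually_mono)
    qed
    then have "(\<lambda>j. cf_convergent (Suc n) (S j)) \<longlonglongrightarrow> 0"
      by (intro tendstoI) (simp add: dist_real_def del: cf_convergent.simps)
    then show ?thesis using x infinity by simp
  qed
qed simp

text \<open>
  A uniform limit of continuous functions is continuous; the convergents are continuous because
  \<open>1 / m\<close> tends to \<open>0\<close> as the entry \<open>m\<close> tends to \<open>\<infinity>\<close>.
\<close>

lemma cf_value_entries_tend:
  assumes "\<And>j. positive_entries (S j)" "expansion_sequence s" "entries_tend S s"
  shows "(\<lambda>j. cf_value (S j)) \<longlonglongrightarrow> cf_value s"
proof (rule tendstoI)
  fix e :: real assume "0 < e"
  then obtain n where "inverse (real (Suc n)) < e / 3"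
    using reals_Archimedean[of "e / 3"] by auto
  then have n: "1 / real (Suc n) < e / 3"
    by (simp add: inverse_eq_divide)
  have "\<forall>\<^sub>F j in sequentially. dist (cf_convergent n (S j)) (cf_convergent n s) < e / 3"
    using cf_convergent_entries_tend[OF assms, of n] \<open>0 < e\<close> by (intro tendstoD) auto
  then show "\<forall>\<^sub>F j in sequentially. dist (cf_value (S j)) (cf_value s) < e"
  proof (rule eventually_mono)
    fix j assume "dist (cf_convergent n (S j)) (cf_convergent n s) < e / 3"
    then show "dist (cf_value (S j)) (cf_value s) < e"
      using cf_value_diff_le[OF assms(1), of j n] n
        cf_value_diff_le[OF expansion_sequence_positive[OF assms(2)], of n]
      unfolding dist_real_def by linarith
  qed
qed


section \<open>Compactness of the space of sequences\<close>

text \<open>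
  A diagonal argument, with undefined terms read as \<open>\<infinity>\<close>. The entrywise limit may contain several
  entries \<open>\<infinity>\<close>; it is cut off after the first one, which is consistent with \<open>entries_tend\<close>.
\<close>

lemma expansion_sequence_compact:
  assumes S: "\<And>j. expansion_sequence (S j)"
  obtains r s where "strict_mono (r :: nat \<Rightarrow> nat)" "expansion_sequence s"
    "entries_tend (\<lambda>j. S (r j)) s"
proof -
  define entry where "entry j i = (case S j i of None \<Rightarrow> \<infinity> | Some x \<Rightarrow> x)" for j i
  have entry_pos: "0 < entry j i" for j i
    using expansion_sequence_positive[OF S[of j]]
    by (auto simp: entry_def positive_entries_def split: option.split)
  have entry_finite: "S j i = Some (enat n)" if "entry j i = enat n" for j i n
    using that by (auto simp: entry_def split: option.splits)
  interpret subseqs "\<lambda>i r. \<exists>x. (\<lambda>j. entry (r j) i) \<longlonglongrightarrow> x"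
  proof
    fix i and r :: "nat \<Rightarrow> nat"
    show "\<exists>r'. strict_mono r' \<and> (\<exists>x. (\<lambda>j. entry ((r \<circ> r') j) i) \<longlonglongrightarrow> x)"
      using compact_complete_linorder[of "\<lambda>j. entry (r j) i"] by (auto simp: o_def)
  qed
  have "\<exists>x. (\<lambda>j. entry (diagseq j) i) \<longlonglongrightarrow> x" for i
  proof -
    have "\<exists>x. (\<lambda>j. entry ((diagseq \<circ> ((+) (Suc i))) j) i) \<longlonglongrightarrow> x"
    proof (rule diagseq_holds)
      fix r s :: "nat \<Rightarrow> nat" and i
      assume "strict_mono r" "\<exists>x. (\<lambda>j. entry (s j) i) \<longlonglongrightarrow> x"
      then show "\<exists>x. (\<lambda>j. entry ((s \<circ> r) j) i) \<longlonglongrightarrow> x"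
        using LIMSEQ_subseq_LIMSEQ[of "\<lambda>j. entry (s j) i" _ r] by (auto simp: o_def)
    qed
    then show ?thesis
      using LIMSEQ_offset[of "\<lambda>j. entry (diagseq j) i" "Suc i"] by (auto simp: add.commute)
  qed
  then obtain c where c: "\<And>i. (\<lambda>j. entry (diagseq j) i) \<longlonglongrightarrow> c i"
    using choice[of "\<lambda>i x. (\<lambda>j. entry (diagseq j) i) \<longlonglongrightarrow> x"] by blast
  define s where "s i = (if \<forall>m<i. c m \<noteq> \<infinity> then Some (c i) else None)" for i
  have finite: "\<forall>\<^sub>F j in sequentially. S (diagseq j) i = Some (enat n)" if "c i = enat n" for i n
  proof -
    have "\<forall>\<^sub>F j in sequentially. entry (diagseq j) i \<in> {enat n}"
      using topological_tendstoD[OF c[of i] open_enat] that by simp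
    then show ?thesis
      by eventually_elim (simp add: entry_finite)
  qed
  have c_pos: "0 < c i" for i
  proof (rule ccontr)
    assume "\<not> 0 < c i"
    then have "\<forall>\<^sub>F j in sequentially. S (diagseq j) i = Some (enat 0)"
      by (intro finite) (simp add: enat_0)
    then obtain j where "S (diagseq j) i = Some (enat 0)"
      using eventually_happens sequentially_bot by blast
    then show False
      using positive_entries_enatD[OF expansion_sequence_positive[OF S]] by blast
  qed
  have "expansion_sequence s"
    unfolding expansion_sequence_iff positive_entries_def
    using c_pos by (auto simp: s_def less_Suc_eq split: if_splits)
  moreover have "entries_tend (\<lambda>j. S (diagseq j)) s"
    unfolding entries_tend_def
  proof (intro conjI allI impI)
    fix i n assume "s i = Some (enat n)"
    then show "\<forall>\<^sub>F j in sequentially. S (diagseq j) i = Some (enat n)"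
      by (intro finite) (auto simp: s_def split: if_splits)
  next
    fix i C assume "s i = Some \<infinity>"
    then have before: "\<forall>m<i. c m \<noteq> \<infinity>" and i: "c i = \<infinity>"
      by (auto simp: s_def split: if_splits)
    have "\<forall>\<^sub>F j in sequentially. \<exists>n. S (diagseq j) m = Some (enat n)" if m: "m < i" for m
    proof -
      obtain n where "c m = enat n"
        using before m by (cases "c m") auto
      from finite[OF this] show ?thesis
        by (rule eventually_mono) blast
    qed
    then have "\<forall>\<^sub>F j in sequentially. \<forall>m\<in>{..<i}. \<exists>n. S (diagseq j) m = Some (enat n)"
      by (intro eventually_ball_finite) auto
    moreover have "\<forall>\<^sub>F j in sequentially. enat C < entry (diagseq j) i"
      using order_tendstoD(1)[OF c[of i]] i by simp
    ultimately show "\<forall>\<^sub>F j in sequentially. \<exists>x. S (diagseq j) i = Some x \<and> enat C < x"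
    proof eventually_elim
      case (elim j)
      have "S (diagseq j) i \<noteq> None"
      proof (cases i)
        case 0
        then show ?thesis using S by (simp add: expansion_sequence_iff)
      next
        case (Suc k)
        have "S (diagseq j) (Suc k) \<noteq> None \<longleftrightarrow> (\<exists>n. S (diagseq j) k = Some (enat n))"
          using S[of "diagseq j"] unfolding expansion_sequence_iff by blast
        then show ?thesis
          using elim(1) Suc by simp
      qed
      then show ?case
        using elim(2) by (auto simp: entry_def)
    qed
  qed
  ultimately show thesis
    using that subseq_diagseq by blast
qed

lemma entries_tend_subseq:
  "strict_mono r \<Longrightarrow> entries_tend A a \<Longrightarrow> entries_tend (\<lambda>j. A (r j)) a"
  unfolding entries_tend_def
  using eventually_subseq[of r "\<lambda>j. A j i = Some (enat n)" for i n]
    eventually_subseq[of r "\<lambda>j. \<exists>x. A j i = Some x \<and> enat C < x" for i C]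
  by blast

lemma admissible_compact:
  assumes A: "\<And>j. admissible (A j)"
  obtains r a where "strict_mono (r :: nat \<Rightarrow> nat)" "admissible a" "entries_tend (\<lambda>j. A (r j)) a"
proof -
  obtain r1 s where r1: "strict_mono (r1 :: nat \<Rightarrow> nat)" and s: "expansion_sequence s"
    "entries_tend (\<lambda>j. right_of (A (r1 j)) (-1)) s"
    using expansion_sequence_compact[of "\<lambda>j. right_of (A j) (-1)"] A
    unfolding admissible_def by metis
  obtain r2 t where r2: "strict_mono (r2 :: nat \<Rightarrow> nat)" and t: "expansion_sequence t"
    "entries_tend (\<lambda>j. left_of (A (r1 (r2 j))) 0) t"
    using expansion_sequence_compact[of "\<lambda>j. left_of (A (r1 j)) 0"] A
    unfolding admissible_def by metis
  define a where "a i = (if 0 \<le> i then s (nat i) else t (nat (- 1 - i)))" for i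
  have "right_of a (-1) = s" "left_of a 0 = t"
    by (auto simp: a_def right_of_def left_of_def fun_eq_iff)
  then have "admissible a"
    using s t by (simp add: admissible_def)
  moreover have "entries_tend (\<lambda>j. A (r1 (r2 j))) a"
  proof -
    have right: "A j i = right_of (A j) (-1) (nat i)" if "0 \<le> i" for j i
      using that by (simp add: right_of_def)
    have left: "A j i = left_of (A j) 0 (nat (- 1 - i))" if "\<not> 0 \<le> i" for j i
      using that by (simp add: left_of_def)
    show ?thesis
      using entries_tend_subseq[OF r2 s(2)] t(2) unfolding entries_tend_def a_def
      by (auto simp: right left split: if_splits)
  qed
  moreover have "strict_mono (r1 \<circ> r2)"
    using r1 r2 by (rule strict_mono_o)
  ultimately show thesis
    using that[of "r1 \<circ> r2"] by simp
qed

section \<open>Positions at which a value is defined\<close>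

text \<open>
  The sequence can be cut between the positions \<open>k - 1\<close> and \<open>k\<close>. Admissibility is the case
  \<open>k = 0\<close>, and the property is carried from one position to the next by finite entries.
\<close>

definition splits_at :: "(int \<Rightarrow> enat option) \<Rightarrow> int \<Rightarrow> bool" where
  "splits_at a k \<longleftrightarrow> expansion_sequence (right_of a (k - 1)) \<and> expansion_sequence (left_of a k)"

lemma admissible_iff_splits_at: "admissible a \<longleftrightarrow> splits_at a 0"
  by (simp add: admissible_def splits_at_def)

lemma splits_at_shift: "splits_at (\<lambda>i. a (i + d)) k \<longleftrightarrow> splits_at a (k + d)"
  by (simp add: splits_at_def right_of_def left_of_def algebra_simps)

lemma right_of_Suc: "right_of a (k - 1) (Suc i) = right_of a k i"
  by (simp add: right_of_def algebra_simps)

lemma left_of_Suc: "left_of a (k + 1) (Suc i) = left_of a k i"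
  by (simp add: left_of_def algebra_simps)

lemma expansion_sequence_right_move:
  assumes "k \<le> k'" "\<And>m. k \<le> m \<Longrightarrow> m < k' \<Longrightarrow> \<exists>n>0. a m = Some (enat n)"
  shows "expansion_sequence (right_of a (k - 1)) \<longleftrightarrow> expansion_sequence (right_of a (k' - 1))"
  using assms
proof (induction k' rule: int_ge_induct)
  case (step k')
  obtain n where "0 < n" "right_of a (k' - 1) 0 = Some (enat n)"
    using step.prems[of k'] step.hyps by (auto simp: right_of_def)
  then have "expansion_sequence (right_of a (k' - 1)) \<longleftrightarrow> expansion_sequence (right_of a k')"
    using expansion_sequence_Cons[of "right_of a (k' - 1)" n] by (simp add: right_of_Suc)
  then show ?case using step by simp
qed simp

lemma expansion_sequence_left_move:
  assumes "k \<le> k'" "\<And>m. k \<le> m \<Longrightarrow> m < k' \<Longrightarrow> \<exists>n>0. a m = Some (enat n)"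
  shows "expansion_sequence (left_of a k) \<longleftrightarrow> expansion_sequence (left_of a k')"
  using assms
proof (induction k' rule: int_ge_induct)
  case (step k')
  obtain n where "0 < n" "left_of a (k' + 1) 0 = Some (enat n)"
    using step.prems[of k'] step.hyps by (auto simp: left_of_def)
  then have "expansion_sequence (left_of a (k' + 1)) \<longleftrightarrow> expansion_sequence (left_of a k')"
    using expansion_sequence_Cons[of "left_of a (k' + 1)" n] by (simp add: left_of_Suc)
  then show ?case using step by simp
qed simp

lemma splits_at_move:
  assumes "k \<le> k'" "\<And>m. k \<le> m \<Longrightarrow> m < k' \<Longrightarrow> \<exists>n>0. a m = Some (enat n)"
  shows "splits_at a k \<longleftrightarrow> splits_at a k'"
  using expansion_sequence_right_move[of k k' a] expansion_sequence_left_move[of k k' a] assms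
  by (simp add: splits_at_def)

lemma splits_at_step: "\<exists>n>0. a k = Some (enat n) \<Longrightarrow> splits_at a k \<longleftrightarrow> splits_at a (k + 1)"
  by (rule splits_at_move) (auto simp: zless_add1_eq)

lemma splits_at_defined:
  assumes "splits_at a k"
  shows "a k \<noteq> None" "a (k - 1) \<noteq> None"
  using assms by (auto simp: splits_at_def expansion_sequence_iff right_of_def left_of_def)

lemma splits_at_finite_right:
  assumes "splits_at a k" "a p \<noteq> None" "k \<le> m" "m < p"
  shows "\<exists>n>0. a m = Some (enat n)"
  using expansion_sequence_finite_before[of "right_of a (k - 1)" "nat (p - k)" "nat (m - k)"] assms
  by (simp add: splits_at_def right_of_def)

lemma splits_at_finite_left:
  assumes "splits_at a k" "a p \<noteq> None" "p < m" "m < k"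
  shows "\<exists>n>0. a m = Some (enat n)"
  using expansion_sequence_finite_before[of "left_of a k" "nat (k - 1 - p)" "nat (k - 1 - m)"] assms
  by (simp add: splits_at_def left_of_def)

lemma splits_at_finite_between:
  assumes "splits_at a k" "splits_at a k'" "k \<le> m" "m < k'"
  shows "\<exists>n>0. a m = Some (enat n)"
  using splits_at_finite_left[OF assms(2) splits_at_defined(2)[OF assms(1)]] assms(3,4) by simp

lemma splits_at_positive:
  assumes "splits_at a k"
  shows "positive_entries a"
  unfolding positive_entries_def
proof (intro allI impI)
  fix i x assume "a i = Some x"
  then have "right_of a (k - 1) (nat (i - k)) = Some x \<or> left_of a k (nat (k - 1 - i)) = Some x"
    by (auto simp: right_of_def left_of_def)
  then show "0 < x"
    using assms by (auto simp: splits_at_def expansion_sequence_iff positive_entries_def)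
qed

text \<open>
  A defined entry may be the terminal \<open>\<infinity>\<close> of either side, so only one of the two cuts next to it
  is guaranteed.
\<close>

lemma splits_at_next_to_defined:
  assumes "splits_at a k" "a p \<noteq> None"
  shows "\<exists>q\<in>{p, p + 1}. splits_at a q"
proof (cases "k \<le> p")
  case True
  then show ?thesis
    using splits_at_move[of k p a] splits_at_finite_right[OF assms] assms(1) by blast
next
  case False
  then have "splits_at a (p + 1)"
    using splits_at_move[of "p + 1" k a] splits_at_finite_left[OF assms] assms(1) by auto
  then show ?thesis by blast
qed

text \<open>
  Next to a cut the entries are defined. If they are not \<open>\<infinity>\<close> they are finite, and the cut moves on
  in both directions until it reaches the ends of the window.
\<close>

lemma splits_at_window:
  assumes "splits_at a q" "k \<le> q" "q \<le> k'"
    and no_inf: "\<And>m. k \<le> m \<Longrightarrow> m < k' \<Longrightarrow> a m \<noteq> Some \<infinity>"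
  shows "splits_at a k \<and> splits_at a k'"
proof
  have finite: "\<exists>n>0. a m = Some (enat n)" if m: "a m \<noteq> None" "k \<le> m" "m < k'" for m
  proof -
    obtain n where "a m = Some (enat n)"
      using m(1) no_inf[OF m(2,3)] by (cases "a m"; cases "the (a m)") auto
    then show ?thesis
      using positive_entries_enatD[OF splits_at_positive[OF assms(1)]] by blast
  qed
  have "k' \<le> k' \<longrightarrow> splits_at a k'" using \<open>q \<le> k'\<close>
  proof (induction k' rule: int_ge_induct[where k = q and ?P = "\<lambda>i. i \<le> k' \<longrightarrow> splits_at a i"])
    case (step i)
    then show ?case
      using splits_at_step[of a i] finite[of i] splits_at_defined(1)[of a i] \<open>k \<le> q\<close>
      by auto
  qed (use assms(1) in simp)
  then show "splits_at a k'" by simp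
  have "k \<le> k \<longrightarrow> splits_at a k" using \<open>k \<le> q\<close>
  proof (induction k rule: int_le_induct[where k = q and ?P = "\<lambda>i. k \<le> i \<longrightarrow> splits_at a i"])
    case (step i)
    then show ?case
      using splits_at_step[of a "i - 1"] finite[of "i - 1"] splits_at_defined(2)[of a i] \<open>q \<le> k'\<close>
      by auto
  qed (use assms(1) in simp)
  then show "splits_at a k" by simp
qed

lemma window_infinite_iff:
  "(\<exists>i<l. a (k + int i) = Some \<infinity>) \<longleftrightarrow> (\<exists>m. k \<le> m \<and> m < k + int l \<and> a m = Some \<infinity>)"
proof
  assume "\<exists>m. k \<le> m \<and> m < k + int l \<and> a m = Some \<infinity>"
  then obtain m where "k \<le> m" "m < k + int l" "a m = Some \<infinity>" by blast
  then show "\<exists>i<l. a (k + int i) = Some \<infinity>"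
    by (intro exI[of _ "nat (m - k)"]) auto
next
  assume "\<exists>i<l. a (k + int i) = Some \<infinity>"
  then obtain i where "i < l" "a (k + int i) = Some \<infinity>" by blast
  then show "\<exists>m. k \<le> m \<and> m < k + int l \<and> a m = Some \<infinity>"
    by (intro exI[of _ "k + int i"]) auto
qed

text \<open>
  The definition asks for the expansion to the right of the window and the one to the left of it.
  Both can be carried across the window because its entries are finite, so the two conditions
  become the symmetric one that the sequence can be cut at both ends of the window.
\<close>

lemma perron_value_splits_at:
  assumes "positive_entries a"
  shows "perron_value l f I a k =
    (if \<exists>i<l. a (k + int i) = Some \<infinity> then Some I
     else if splits_at a k \<and> splits_at a (k + int l)
     then Some (f (cf_alpha a (k + int l - 1)) (cf_beta a k) (map (\<lambda>i. the (a (k + int i))) [0..<l]))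
     else None)"
proof (cases "\<exists>i<l. a (k + int i) = Some \<infinity>")
  case True
  then show ?thesis by (simp add: perron_value_def)
next
  case False
  then have no_inf: "(\<exists>i<l. a (k + int i) = Some \<infinity>) = False" by simp
  have "((\<forall>i<l. a (k + int i) \<noteq> None) \<and> expansion_sequence (right_of a (k + int l - 1)) \<and>
      expansion_sequence (left_of a k)) \<longleftrightarrow> splits_at a k \<and> splits_at a (k + int l)" (is "?L \<longleftrightarrow> ?R")
  proof
    assume L: ?L
    have "\<exists>n>0. a m = Some (enat n)" if m: "k \<le> m" "m < k + int l" for m
    proof -
      obtain i where "m = k + int i" "i < l"
        using m by (metis add_less_cancel_left of_nat_less_iff zle_iff_zadd)
      then have "a m \<noteq> None" "a m \<noteq> Some \<infinity>"
        using L False by auto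
      then obtain n where "a m = Some (enat n)"
        by (cases "a m"; cases "the (a m)") auto
      then show ?thesis
        using positive_entries_enatD[OF assms] by blast
    qed
    then show ?R
      using expansion_sequence_right_move[of k "k + int l" a]
        expansion_sequence_left_move[of k "k + int l" a] L
      by (simp add: splits_at_def)
  next
    assume R: ?R
    have "a (k + int i) \<noteq> None" if "i < l" for i
      using splits_at_finite_between[of a k "k + int l" "k + int i"] R that by auto
    then show ?L using R by (simp add: splits_at_def)
  qed
  then show ?thesis
    unfolding perron_value_def by (simp only: no_inf if_False)
qed

text \<open>
  A single cut inside the window or at one of its ends is enough for the value to exist. This
  supplies the values of approximating sequences whose window may or may not contain \<open>\<infinity>\<close>.
\<close>

lemma perron_value_defined:
  assumes "splits_at a q" "k \<le> q" "q \<le> k + int l"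
  shows "perron_value l f I a k \<noteq> None"
proof (cases "\<exists>i<l. a (k + int i) = Some \<infinity>")
  case True
  then show ?thesis by (simp add: perron_value_def)
next
  case False
  then have "splits_at a k \<and> splits_at a (k + int l)"
    using splits_at_window[OF assms] unfolding window_infinite_iff by blast
  then show ?thesis
    using perron_value_splits_at[OF splits_at_positive[OF assms(1)]] by simp
qed

lemma perron_value_shift:
  "perron_value l f I (\<lambda>i. a (i + d)) k = perron_value l f I a (k + d)"
proof -
  have "right_of (\<lambda>i. a (i + d)) n = right_of a (n + d)" "left_of (\<lambda>i. a (i + d)) n = left_of a (n + d)"
    "k + int i + d = k + d + int i" "k + int l - 1 + d = k + d + int l - 1" for n i
    by (simp_all add: right_of_def left_of_def algebra_simps)
  then show ?thesis
    by (simp only: perron_value_def cf_alpha_def cf_beta_def)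
qed

section \<open>Convergence of the values and closedness of the spectra\<close>


lemma good_continuity_near_infinity:
  assumes "good_continuity l f I" "open B" "I \<in> B"
  obtains C where "\<And>\<alpha> \<beta> ns n. \<alpha> \<in> {0..1} \<Longrightarrow> \<beta> \<in> {0..1} \<Longrightarrow> ns \<in> perron_args l \<Longrightarrow>
    n \<in> set ns \<Longrightarrow> enat C < n \<Longrightarrow> f \<alpha> \<beta> ns \<in> B"
proof -
  have "\<exists>C::nat. \<forall>\<alpha>\<in>{0..1}. \<forall>\<beta>\<in>{0..1}. \<forall>ns\<in>perron_args l.
      (\<exists>n\<in>set ns. enat C < n) \<longrightarrow> f \<alpha> \<beta> ns \<in> B"
    using spec[OF conjunct1[OF assms(1)[unfolded good_continuity_def]], of B] assms(2,3) by simp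
  then obtain C :: nat where C: "\<forall>\<alpha>\<in>{0..1}. \<forall>\<beta>\<in>{0..1}. \<forall>ns\<in>perron_args l.
      (\<exists>n\<in>set ns. enat C < n) \<longrightarrow> f \<alpha> \<beta> ns \<in> B" ..
  show thesis
    by (rule that[of C], rule C[rule_format]) auto
qed

abbreviation window :: "nat \<Rightarrow> (int \<Rightarrow> enat option) \<Rightarrow> int \<Rightarrow> enat list" where
  "window l a k \<equiv> map (\<lambda>i. the (a (k + int i))) [0..<l]"

lemma perron_value_cases:
  assumes "admissible a" "perron_value l f I a k = Some z"
  obtains (infinite) i where "i < l" "a (k + int i) = Some \<infinity>" "z = I"
  | (finite) "\<And>i. i < l \<Longrightarrow> \<exists>n. a (k + int i) = Some (enat n)"
      "splits_at a k" "splits_at a (k + int l)"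
      "cf_alpha a (k + int l - 1) \<in> {0..1}" "cf_beta a k \<in> {0..1}" "window l a k \<in> perron_args l"
      "z = f (cf_alpha a (k + int l - 1)) (cf_beta a k) (window l a k)"
proof (cases "\<exists>i<l. a (k + int i) = Some \<infinity>")
  case True
  then show thesis
    using assms(2) infinite by (auto simp: perron_value_def)
next
  case False
  have pos: "positive_entries a"
    using assms(1) splits_at_positive admissible_iff_splits_at by blast
  have splits: "splits_at a k" "splits_at a (k + int l)"
    and z: "z = f (cf_alpha a (k + int l - 1)) (cf_beta a k) (window l a k)"
    using assms(2) False unfolding perron_value_splits_at[OF pos] by (auto split: if_splits)
  have fin: "\<exists>n>0. a (k + int i) = Some (enat n)" if "i < l" for i
    using splits_at_finite_between[OF splits] that by simp
  have "positive_entries (right_of a (k + int l - 1))" "positive_entries (left_of a k)"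
    using splits by (auto simp: splits_at_def expansion_sequence_positive)
  then have "cf_alpha a (k + int l - 1) \<in> {0..1}" "cf_beta a k \<in> {0..1}"
    unfolding cf_alpha_def cf_beta_def using cf_value_bounds by blast+
  moreover have "window l a k \<in> perron_args l"
    using fin by (fastforce simp: perron_args_def zero_enat_def)
  moreover have "\<exists>n. a (k + int i) = Some (enat n)" if "i < l" for i
    using fin[OF that] by blast
  ultimately show thesis
    using finite splits z by simp
qed

text \<open>
  A cut at \<open>q\<close> is equivalent to the finiteness of the entries between \<open>0\<close> and \<open>q\<close>; these finitely many
  entries are eventually shared with the limit.
\<close>

lemma splits_at_eventually:
  assumes "\<And>j. admissible (A j)" "admissible a" "entries_tend A a" "splits_at a q"
  shows "\<forall>\<^sub>F j in sequentially. splits_at (A j) q"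
proof -
  define lo hi where "lo = min 0 q" and "hi = max 0 q"
  have ends: "lo = 0 \<and> hi = q \<or> lo = q \<and> hi = 0" "lo \<le> hi"
    by (auto simp: lo_def hi_def)
  have "\<forall>\<^sub>F j in sequentially. \<exists>n>0. A j m = Some (enat n)" if m: "lo \<le> m" "m < hi" for m
  proof -
    have "splits_at a lo" "splits_at a hi"
      using assms(2,4) ends by (auto simp: admissible_iff_splits_at)
    then have "\<exists>n>0. a m = Some (enat n)"
      using m by (rule splits_at_finite_between)
    then obtain n where n: "0 < n" "a m = Some (enat n)" by auto
    show ?thesis
      using entries_tend_finite[OF assms(3) n(2)] by (rule eventually_mono) (use n(1) in simp)
  qed
  then have "\<forall>\<^sub>F j in sequentially. \<forall>m\<in>{lo..<hi}. \<exists>n>0. A j m = Some (enat n)"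
    by (intro eventually_ball_finite) auto
  then show ?thesis
  proof eventually_elim
    case (elim j)
    then have "splits_at (A j) lo \<longleftrightarrow> splits_at (A j) hi"
      using ends by (intro splits_at_move) auto
    then show ?case
      using assms(1)[of j] ends by (auto simp: admissible_iff_splits_at)
  qed
qed

text \<open>
  Where the window of the limit is finite, this is the continuity of \<open>f\<close> and of the continued
  fractions. Where it contains \<open>\<infinity>\<close>, the window of the approximating sequence contains a large entry;
  then either all its entries are finite, and the value is close to \<open>I\<close> by the uniform limit at
  infinity, or the value is \<open>I\<close>.
\<close>

lemma perron_value_entries_tend:
  assumes good: "good_continuity l f I"
    and A: "\<And>j. admissible (A j)" and a: "admissible a" "entries_tend A a"
    and y: "perron_value l f I a k = Some y" and B: "open B" "y \<in> B"
  shows "\<forall>\<^sub>F j in sequentially. \<exists>z\<in>B. perron_value l f I (A j) k = Some z"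
  using a(1) y
proof (cases rule: perron_value_cases)
  case (infinite i)
  from good B have "open B" "I \<in> B"
    using infinite(3) by simp_all
  then obtain C where C: "\<And>\<alpha> \<beta> ns n. \<alpha> \<in> {0..1} \<Longrightarrow> \<beta> \<in> {0..1} \<Longrightarrow> ns \<in> perron_args l \<Longrightarrow>
      n \<in> set ns \<Longrightarrow> enat C < n \<Longrightarrow> f \<alpha> \<beta> ns \<in> B"
    using good_continuity_near_infinity[OF good] by metis
  obtain q where q: "q = k + int i \<or> q = k + int i + 1" "splits_at a q"
    using splits_at_next_to_defined[of a 0 "k + int i"] a(1) infinite(2)
    by (auto simp: admissible_iff_splits_at)
  have "\<forall>\<^sub>F j in sequentially. splits_at (A j) q"
    by (rule splits_at_eventually) (use A a q in auto)
  moreover have "\<forall>\<^sub>F j in sequentially. \<exists>x. A j (k + int i) = Some x \<and> enat C < x"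
    using entries_tend_infinite[OF a(2) infinite(2)] .
  ultimately show ?thesis
  proof eventually_elim
    case (elim j)
    have "k \<le> q" "q \<le> k + int l"
      using q(1) infinite(1) by auto
    then obtain z where z: "perron_value l f I (A j) k = Some z"
      using perron_value_defined[OF elim(1)] by blast
    with A have "z \<in> B"
    proof (cases rule: perron_value_cases)
      case finite
      have "the (A j (k + int i)) \<in> set (window l (A j) k)"
        using infinite(1) by auto
      moreover have "enat C < the (A j (k + int i))"
        using elim(2) by auto
      ultimately show ?thesis
        using C[OF finite(4-6)] finite(7) by simp
    qed (use B infinite(3) in auto)
    then show ?case using z by blast
  qed
next
  case finite
  define g where "g = (\<lambda>(\<alpha>, \<beta>). f \<alpha> \<beta> (window l a k))"
  define point where
    "point b = (cf_alpha b (k + int l - 1), cf_beta b k)" for b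
  have no_inf: "\<infinity> \<notin> set (window l a k)"
    using finite(1) by force
  have splits: "\<forall>\<^sub>F j in sequentially. splits_at (A j) k" "\<forall>\<^sub>F j in sequentially. splits_at (A j) (k + int l)"
    by (rule splits_at_eventually; use A a finite in auto)+
  have "\<forall>\<^sub>F j in sequentially. A j (k + int i) = a (k + int i)" if "i < l" for i
    using finite(1)[OF that] entries_tend_finite[OF a(2)] by auto
  then have "\<forall>\<^sub>F j in sequentially. \<forall>i\<in>{..<l}. A j (k + int i) = a (k + int i)"
    by (intro eventually_ball_finite) auto
  then have eq: "\<forall>\<^sub>F j in sequentially. perron_value l f I (A j) k = Some (g (point (A j))) \<and>
      point (A j) \<in> {0..1} \<times> {0..1}"
    using splits
  proof eventually_elim
    case (elim j)
    have same: "window l (A j) k = window l a k"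
      using elim(1) by simp
    have "k \<le> k + int l" by simp
    then obtain z where z: "perron_value l f I (A j) k = Some z"
      using perron_value_defined[OF elim(2)] by blast
    with A show ?case
    proof (cases rule: perron_value_cases)
      case (infinite i)
      then show ?thesis using elim(1) finite(1)[of i] by auto
    next
      case finite
      then show ?thesis using z unfolding g_def point_def by (simp add: same)
    qed
  qed
  have pos: "positive_entries (right_of (A j) n)" "positive_entries (left_of (A j) n)" for j n
    using splits_at_positive[of "A j" 0] A[of j]
    by (auto simp: admissible_iff_splits_at positive_entries_def right_of_def left_of_def)
  have tend: "entries_tend (\<lambda>j. right_of (A j) n) (right_of a n)"
    "entries_tend (\<lambda>j. left_of (A j) n) (left_of a n)" for n
    unfolding right_of_def left_of_def by (rule entries_tend_reindex[OF a(2)])+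
  have "expansion_sequence (right_of a (k + int l - 1))" "expansion_sequence (left_of a k)"
    using finite(2,3) by (auto simp: splits_at_def)
  then have point: "(\<lambda>j. point (A j)) \<longlonglongrightarrow> point a"
    unfolding point_def cf_alpha_def cf_beta_def
    by (intro tendsto_Pair cf_value_entries_tend pos tend)
  have cont: "continuous_on ({0..1} \<times> {0..1}) g"
    using good finite(6) no_inf unfolding good_continuity_def g_def by blast
  have "point a \<in> {0..1} \<times> {0..1}"
    using finite(4,5) by (simp add: point_def)
  moreover have "\<forall>\<^sub>F j in sequentially. point (A j) \<in> {0..1} \<times> {0..1}"
    using eq by (rule eventually_mono) simp
  ultimately have "(\<lambda>j. g (point (A j))) \<longlonglongrightarrow> g (point a)"
    by (rule continuous_on_tendsto_compose[OF cont point])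
  moreover have "g (point a) \<in> B"
    using B(2) finite(7) by (simp add: g_def point_def)
  ultimately have "\<forall>\<^sub>F j in sequentially. g (point (A j)) \<in> B"
    using B(1) by (auto dest: topological_tendstoD)
  then show ?thesis
    using eq by eventually_elim auto
qed

lemma perron_value_zero_defined:
  assumes "admissible a"
  shows "perron_value l f I a 0 \<noteq> None"
  using perron_value_defined[of a 0 0 l] assms by (simp add: admissible_iff_splits_at)

text \<open>
  Lower bounds pass to the limit because every value of the limit sequence is approximated by values
  of the \<open>A j\<close>. That the bound \<open>X\<close> is attained is forced at the fixed position \<open>0\<close>, where the limit
  sequence has a value and this value is the limit of the \<open>y j\<close>.
\<close>

lemma perron_values_limit:
  assumes good: "good_continuity l f I"
    and A: "\<And>j. admissible (A j)" "\<And>j. perron_value l f I (A j) 0 = Some (y j)"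
    and x: "\<And>j z. z \<in> perron_values l f I (A j) \<Longrightarrow> x j \<le> z"
    and lim: "x \<longlonglongrightarrow> X" "y \<longlonglongrightarrow> X"
  obtains a where "admissible a" "perron_value l f I a 0 = Some X" "Inf (perron_values l f I a) = X"
proof -
  obtain r a where r: "strict_mono (r :: nat \<Rightarrow> nat)" and a: "admissible a" "entries_tend (\<lambda>j. A (r j)) a"
    using admissible_compact[of A, OF A(1)] by metis
  have near: "\<forall>\<^sub>F j in sequentially. \<exists>z\<in>B. perron_value l f I (A (r j)) k = Some z"
    if "perron_value l f I a k = Some z" "open B" "z \<in> B" for k z B
    using perron_value_entries_tend[of l f I "\<lambda>j. A (r j)", OF good A(1) a that] .
  have limr: "(\<lambda>j. x (r j)) \<longlonglongrightarrow> X" "(\<lambda>j. y (r j)) \<longlonglongrightarrow> X"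
    using lim LIMSEQ_subseq_LIMSEQ[OF _ r] by (auto simp: o_def)
  have lower: "X \<le> z" if "z \<in> perron_values l f I a" for z
  proof (rule ccontr)
    assume "\<not> X \<le> z"
    then obtain w where w: "z < w" "w < X"
      using dense[of z X] by (auto simp: not_le)
    obtain k where "perron_value l f I a k = Some z"
      using \<open>z \<in> perron_values l f I a\<close> by (auto simp: perron_values_def)
    then have "\<forall>\<^sub>F j in sequentially. \<exists>z\<in>{..<w}. perron_value l f I (A (r j)) k = Some z"
      by (rule near) (use w in auto)
    moreover have "\<forall>\<^sub>F j in sequentially. w < x (r j)"
      using order_tendstoD(1)[OF limr(1) w(2)] .
    ultimately have "\<forall>\<^sub>F j in sequentially. False"
    proof eventually_elim
      case (elim j)
      then obtain z' where "z' < w" "z' \<in> perron_values l f I (A (r j))"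
        by (auto simp: perron_values_def)
      then show False using x elim(2) by fastforce
    qed
    then show False by simp
  qed
  obtain y0 where y0: "perron_value l f I a 0 = Some y0"
    using perron_value_zero_defined[OF a(1)] by blast
  then have mem: "y0 \<in> perron_values l f I a"
    by (auto simp: perron_values_def)
  have "y0 \<le> X"
  proof (rule ccontr)
    assume "\<not> y0 \<le> X"
    then obtain w where w: "X < w" "w < y0"
      using dense[of X y0] by (auto simp: not_le)
    have "\<forall>\<^sub>F j in sequentially. \<exists>z\<in>{w<..}. perron_value l f I (A (r j)) 0 = Some z"
      by (rule near[OF y0]) (use w in auto)
    moreover have "\<forall>\<^sub>F j in sequentially. y (r j) < w"
      using order_tendstoD(2)[OF limr(2) w(1)] .
    ultimately have "\<forall>\<^sub>F j in sequentially. False"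
      by eventually_elim (use A(2) in auto)
    then show False by simp
  qed
  then have "y0 = X"
    using lower[OF mem] by simp
  moreover have "Inf (perron_values l f I a) = X"
    using lower mem \<open>y0 = X\<close> by (auto intro!: antisym Inf_greatest Inf_lower)
  ultimately show thesis
    using that a(1) y0 by blast
qed

text \<open>
  A translation moves position \<open>k\<close> to \<open>0\<close> but preserves admissibility only if the sequence can be cut
  at \<open>k\<close>. This may fail when the value is \<open>I\<close> because of an entry \<open>\<infinity>\<close> in the window; then the
  sequence consisting of two entries \<open>\<infinity>\<close> at \<open>-1\<close> and \<open>0\<close>, whose only value is \<open>I\<close>, serves instead.
\<close>

lemma perron_value_recentre:
  assumes "admissible a" "y \<in> perron_values l f I a"
  obtains a' where "admissible a'" "perron_value l f I a' 0 = Some y"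
    "perron_values l f I a' \<subseteq> perron_values l f I a"
proof -
  obtain k where k: "perron_value l f I a k = Some y"
    using assms(2) by (auto simp: perron_values_def)
  show thesis
    using assms(1) k
  proof (cases rule: perron_value_cases)
    case (infinite i)
    define e :: "int \<Rightarrow> enat option" where "e j = (if j = -1 \<or> j = 0 then Some \<infinity> else None)" for j
    have e: "admissible e"
      by (auto simp: admissible_def expansion_sequence_iff positive_entries_def right_of_def
          left_of_def e_def split: if_splits)
    have "perron_value l f I e 0 = Some I"
      using infinite(1) by (auto simp: perron_value_def e_def)
    moreover have "perron_values l f I e \<subseteq> {I}"
    proof
      fix z assume "z \<in> perron_values l f I e"
      then obtain m where "perron_value l f I e m = Some z"
        by (auto simp: perron_values_def)
      with e show "z \<in> {I}"
      proof (cases rule: perron_value_cases)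
        case finite
        then show ?thesis
          using finite(1)[OF infinite(1)] by (auto simp: e_def split: if_splits)
      qed simp
    qed
    ultimately show thesis
      using that[OF e] infinite(3) assms(2) by auto
  next
    case finite
    show thesis
    proof (rule that)
      show "admissible (\<lambda>i. a (i + k))"
        using finite(2) splits_at_shift[of a k 0] by (simp add: admissible_iff_splits_at)
      show "perron_value l f I (\<lambda>i. a (i + k)) 0 = Some y"
        using k perron_value_shift[of l f I a k 0] by simp
      show "perron_values l f I (\<lambda>i. a (i + k)) \<subseteq> perron_values l f I a"
        by (auto simp: perron_values_def perron_value_shift)
    qed
  qed
qed

text \<open>
  The infimum itself need not be a value of \<open>a\<close>, but it is one of a limit of recentrings of \<open>a\<close>.
\<close>

lemma perron_values_Inf_attained:
  assumes good: "good_continuity l f I" and a: "admissible a"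
  obtains a' where "admissible a'" "perron_value l f I a' 0 = Some (Inf (perron_values l f I a))"
    "Inf (perron_values l f I a') = Inf (perron_values l f I a)"
proof -
  let ?V = "perron_values l f I a"
  have "?V \<noteq> {}"
    using perron_value_zero_defined[OF a] by (fastforce simp: perron_values_def)
  then obtain y where y: "\<And>j. y j \<in> ?V" "y \<longlonglongrightarrow> Inf ?V"
    using Inf_as_limit[of ?V] by blast
  have "\<exists>b. admissible b \<and> perron_value l f I b 0 = Some (y j) \<and> perron_values l f I b \<subseteq> ?V" for j
    using perron_value_recentre[OF a y(1)[of j]] by metis
  then obtain A where A: "\<And>j. admissible (A j)" "\<And>j. perron_value l f I (A j) 0 = Some (y j)"
    "\<And>j. perron_values l f I (A j) \<subseteq> ?V"
    by metis
  have "Inf ?V \<le> z" if "z \<in> perron_values l f I (A j)" for j z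
    using that A(3) by (auto intro: Inf_lower)
  then show thesis
    by (rule perron_values_limit[where A = A and y = y and x = "\<lambda>_. Inf ?V" and X = "Inf ?V",
          OF good A(1,2) _ tendsto_const y(2)]) (auto intro: that)
qed

lemma closed_spectrum_inf:
  assumes good: "good_continuity l f I"
  shows "closed (spectrum_inf l f I)"
  unfolding closed_sequential_limits
proof (intro allI impI, elim conjE)
  fix x X assume x: "\<forall>n. x n \<in> spectrum_inf l f I" and lim: "x \<longlonglongrightarrow> X"
  have "\<exists>a. admissible a \<and> perron_value l f I a 0 = Some (x j) \<and> Inf (perron_values l f I a) = x j" for j
  proof -
    obtain a where "admissible a" "x j = Inf (perron_values l f I a)"
      using x by (auto simp: spectrum_inf_def)
    then show ?thesis
      using perron_values_Inf_attained[OF good] by metis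
  qed
  then obtain A where A: "\<And>j. admissible (A j)" "\<And>j. perron_value l f I (A j) 0 = Some (x j)"
    "\<And>j. Inf (perron_values l f I (A j)) = x j"
    by metis
  have "x j \<le> z" if "z \<in> perron_values l f I (A j)" for j z
    using Inf_lower[OF that] A(3) by simp
  then obtain a where "admissible a" "Inf (perron_values l f I a) = X"
    by (rule perron_values_limit[where A = A and y = x and x = x and X = X, OF good A(1,2) _ lim lim])
  then show "X \<in> spectrum_inf l f I"
    by (auto simp: spectrum_inf_def)
qed

lemma good_continuity_uminus:
  assumes good: "good_continuity l f I"
  shows "good_continuity l (\<lambda>\<alpha> \<beta> ns. - f \<alpha> \<beta> ns) (- I)"
  unfolding good_continuity_def
proof (intro conjI allI impI ballI)
  fix B :: "ereal set" assume B: "open B \<and> - I \<in> B"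
  then have "open (uminus ` B)" "I \<in> uminus ` B"
    by (auto simp: ereal_open_uminus intro: image_eqI[of _ _ "- I"])
  then obtain C where C: "\<And>\<alpha> \<beta> ns n. \<alpha> \<in> {0..1} \<Longrightarrow> \<beta> \<in> {0..1} \<Longrightarrow> ns \<in> perron_args l \<Longrightarrow>
      n \<in> set ns \<Longrightarrow> enat C < n \<Longrightarrow> f \<alpha> \<beta> ns \<in> uminus ` B"
    using good_continuity_near_infinity[OF good] by metis
  show "\<exists>C::nat. \<forall>\<alpha>\<in>{0..1}. \<forall>\<beta>\<in>{0..1}. \<forall>ns\<in>perron_args l.
      (\<exists>n\<in>set ns. enat C < n) \<longrightarrow> - f \<alpha> \<beta> ns \<in> B"
  proof (intro exI ballI impI)
    fix \<alpha> \<beta> :: real and ns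
    assume args: "\<alpha> \<in> {0..1}" "\<beta> \<in> {0..1}" "ns \<in> perron_args l" and "\<exists>n\<in>set ns. enat C < n"
    then obtain n where "n \<in> set ns" "enat C < n" by auto
    from C[OF args this] show "- f \<alpha> \<beta> ns \<in> B" by auto
  qed
next
  fix \<alpha> \<beta> :: real and ns
  assume "\<alpha> \<in> {0..1}" "\<beta> \<in> {0..1}" "ns \<in> perron_args l" "\<infinity> \<in> set ns"
  then show "- f \<alpha> \<beta> ns = - I"
    using good unfolding good_continuity_def by auto
next
  fix ns assume "ns \<in> perron_args l" "\<infinity> \<notin> set ns"
  then have "continuous_on ({0..1} \<times> {0..1}) (\<lambda>(\<alpha>, \<beta>). f \<alpha> \<beta> ns)"
    using good unfolding good_continuity_def by blast
  then have "continuous_on ({0..1} \<times> {0..1}) (uminus \<circ> (\<lambda>(\<alpha>, \<beta>). f \<alpha> \<beta> ns))"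
    by (rule continuous_on_compose) (rule continuous_uminus_ereal)
  then show "continuous_on ({0..1} \<times> {0..1}) (\<lambda>(\<alpha>, \<beta>). - f \<alpha> \<beta> ns)"
    by (simp add: o_def case_prod_unfold)
qed

lemma spectrum_sup_eq_uminus_spectrum_inf:
  "spectrum_sup l f I = uminus ` spectrum_inf l (\<lambda>\<alpha> \<beta> ns. - f \<alpha> \<beta> ns) (- I)"
proof -
  have "perron_value l (\<lambda>\<alpha> \<beta> ns. - f \<alpha> \<beta> ns) (- I) a k = map_option uminus (perron_value l f I a k)"
    for a k
    unfolding perron_value_def if_distrib[of "map_option uminus"] option.map by (rule refl)
  then have "perron_values l (\<lambda>\<alpha> \<beta> ns. - f \<alpha> \<beta> ns) (- I) a = uminus ` perron_values l f I a" for a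
    by (auto simp: perron_values_def)
  then have "- Inf (perron_values l (\<lambda>\<alpha> \<beta> ns. - f \<alpha> \<beta> ns) (- I) a) = Sup (perron_values l f I a)" for a
    by (simp add: ereal_Inf_uminus_image_eq)
  then show ?thesis
    by (simp add: spectrum_sup_def spectrum_inf_def setcompr_eq_image image_image)
qed

theorem theorem45:
  fixes l :: nat
    and f :: "real \<Rightarrow> real \<Rightarrow> enat list \<Rightarrow> ereal"
    and I :: ereal
  assumes "good_continuity l f I"
  shows "closed (spectrum_inf l f I) \<and> closed (spectrum_sup l f I)"
proof
  show "closed (spectrum_inf l f I)"
    using assms by (rule closed_spectrum_inf)
  have "closed (spectrum_inf l (\<lambda>\<alpha> \<beta> ns. - f \<alpha> \<beta> ns) (- I))"
    using assms by (intro closed_spectrum_inf good_continuity_uminus)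
  then show "closed (spectrum_sup l f I)"
    unfolding spectrum_sup_eq_uminus_spectrum_inf by (rule ereal_closed_uminus)
qed

end
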